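(* Let $f_1,\dots,f_m$ be rational linear forms on $\mathbb{R}^d$ of constant positive weight ($f_1(\mathbf 1)=\cdots=f_m(\mathbf 1)>0$, $\mathbf 1=(1,\dots,1)$), such that every variable appears in at least one form and $f_1(x)=\cdots=f_m(x)=1$ is consistent; let $s$ be its solution space, $\mathcal O:=\mathbb{R}^d_{\ge0}$, $P:=s\cap\mathcal O$, and $\mathcal{H}:=\{h_{jk}\cap s : h_{jk}\not\supseteq s\}$ where $h_{jk}$ is the hyperplane $x_j=x_k$. Assume a magic labelling exists, i.e. an integer point $x$ with distinct positive coordinates and $f_1(x)=\cdots=f_m(x)$. Let $A^\circ(t)$ be the number of integer points of $tP$ with distinct positive entries and $A(t)$ the number of pairs $(x,\sigma)$ with $x$ a nonnegative integer point of $tP$ and $\sigma$ a permutation of $[d]$ compatible with $x$ and realizable in $P^\circ$. Then $$A^\circ(t)=\sum_{u\in\mathcal{L}(P^\circ,\mathcal{H})}\mu(\hat0,u)\,E_{u\cap\mathcal O^\circ}(t),\qquad A(t)=\sum_{u\in\mathcal{L}(P^\circ,\mathcal{H})}|\mu(\hat0,u)|\,E_{u\cap\mathcal O}(t),$$ where $\mu$ is the Möbius function of $\mathcal{L}(P^\circ,\mathcal{H})$.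
   Context: $\mathcal O^\circ$ is the open positive orthant and $P^\circ$ the relative interior of $P$. $\mathcal{L}(P^\circ,\mathcal{H}) := \{P^\circ\cap\bigcap\mathcal S:\mathcal S\subseteq\mathcal H\}\setminus\{\emptyset\}$ ordered by reverse inclusion, with bottom $\hat0=P^\circ$. For a member $u$, $E_{Q\cap u}(t)$ is the number of integer points in $t(Q\cap\bar u)$, where $\bar u=\bigcap\mathcal S\subseteq s$ is the flat whose intersection with $P^\circ$ is $u$. Möbius function: $\mu(r,r)=1$, $\mu(r,s)=-\sum_{r\le w<s}\mu(r,w)$ for $r<s$. A point realizes permutation $\tau$ if $x_{\tau1}<\cdots<x_{\tau d}$; compatible means $x_{\sigma1}\le\cdots\le x_{\sigma d}$.
   Formalization: Forms with coefficients of mixed sign can make P unbounded and the counts infinite (e.g. x1+x2−x3 gives ∞−∞), so each formula is asserted for those positive integers t at which tP (for A), or its part in the open orthant (for A°), has finitely many integer points. *)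

theory Defs
  imports "HOL-Analysis.Analysis"
begin

text \<open>Coordinates are indexed by a finite type \<open>'n\<close>, which plays the role of
  \<open>[d]\<close> with \<open>d = CARD('n)\<close>; a linear order on it is needed only for permutations.\<close>

definition rational_linear_form :: "(real^'n \<Rightarrow> real) \<Rightarrow> bool" where
  "rational_linear_form g \<longleftrightarrow> linear g \<and> (\<forall>j. g (axis j 1) \<in> \<rat>)"

definition appears_in :: "'n \<Rightarrow> (real^'n \<Rightarrow> real) \<Rightarrow> bool" where
  "appears_in j g \<longleftrightarrow> g (axis j 1) \<noteq> 0"

definition solution_space :: "nat \<Rightarrow> (nat \<Rightarrow> real^'n \<Rightarrow> real) \<Rightarrow> (real^'n) set" where
  "solution_space m f = {x. \<forall>i\<in>{1..m}. f i x = 1}"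

definition orthant :: "(real^'n) set" where
  "orthant = {x. \<forall>j. 0 \<le> x $ j}"

definition open_orthant :: "(real^'n) set" where
  "open_orthant = {x. \<forall>j. 0 < x $ j}"

definition magic_polytope :: "nat \<Rightarrow> (nat \<Rightarrow> real^'n \<Rightarrow> real) \<Rightarrow> (real^'n) set" where
  "magic_polytope m f = solution_space m f \<inter> orthant"

definition hyperplane_eq :: "'n \<Rightarrow> 'n \<Rightarrow> (real^'n) set" where
  "hyperplane_eq j k = {x. x $ j = x $ k}"

definition induced_arrangement :: "(real^'n) set \<Rightarrow> (real^'n) set set" where
  "induced_arrangement s =
     {hyperplane_eq j k \<inter> s | j k. j \<noteq> k \<and> \<not> s \<subseteq> hyperplane_eq j k}"

text \<open>The intersection over the empty subfamily is \<open>UNIV\<close>, so the region \<open>R\<close> itself is a member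
  whenever it is nonempty.\<close>

definition intersection_poset :: "'a set \<Rightarrow> 'a set set \<Rightarrow> 'a set set" where
  "intersection_poset R \<H> = {R \<inter> \<Inter>\<S> | \<S>. \<S> \<subseteq> \<H>} - {{}}"

text \<open>Moebius function of a finite family \<open>L\<close> of sets ordered by reverse inclusion, so that
  \<open>r \<le> w < v\<close> reads \<open>v \<subset> w \<and> w \<subseteq> r\<close>.  The value is 0 outside the intended domain.\<close>

function mobius :: "'a set set \<Rightarrow> 'a set \<Rightarrow> 'a set \<Rightarrow> int" where
  "mobius L r v =
     (if finite L \<and> r \<in> L \<and> v \<in> L then
        if v = r then 1
        else if v \<subset> r then - (\<Sum>w\<in>{w\<in>L. v \<subset> w \<and> w \<subseteq> r}. mobius L r w)
        else 0
      else 0)"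
  by auto
termination
proof (relation "Wellfounded.measure (\<lambda>(L, r, v). card {w\<in>L. v \<subset> w \<and> w \<subseteq> r})", goal_cases)
  case 1
  show ?case by simp
next
  case (2 L r v w)
  then have "{x\<in>L. w \<subset> x \<and> x \<subseteq> r} \<subset> {x\<in>L. v \<subset> x \<and> x \<subseteq> r}"
    by blast
  with 2 show ?case
    by (auto intro!: psubset_card_mono)
qed

declare mobius.simps [simp del]

text \<open>The flat \<open>F\<close> of the arrangement \<open>\<H>\<close> in \<open>s\<close> that cuts out the member \<open>u\<close> of
  \<open>intersection_poset R \<H>\<close>.  The empty subfamily yields \<open>s\<close>.  When \<open>R\<close> is open relative to \<open>s\<close>
  the flat is unique, being the affine hull of \<open>u\<close>.\<close>

definition flat_of ::
    "(real^'n) set \<Rightarrow> (real^'n) set \<Rightarrow> (real^'n) set set \<Rightarrow> (real^'n) set \<Rightarrow> (real^'n) set" where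
  "flat_of s R \<H> u = (THE F. \<exists>\<S>\<subseteq>\<H>. F = s \<inter> \<Inter>\<S> \<and> R \<inter> F = u)"

definition integer_points :: "(real^'n) set \<Rightarrow> (real^'n) set" where
  "integer_points X = {x\<in>X. \<forall>j. x $ j \<in> \<int>}"

definition dilate :: "nat \<Rightarrow> (real^'n) set \<Rightarrow> (real^'n) set" where
  "dilate t X = (\<lambda>x. real t *\<^sub>R x) ` X"

definition ehrhart :: "(real^'n) set \<Rightarrow> nat \<Rightarrow> nat" where
  "ehrhart X t = card (integer_points (dilate t X))"

definition distinct_entries :: "real^'n \<Rightarrow> bool" where
  "distinct_entries x \<longleftrightarrow> inj (\<lambda>j. x $ j)"

definition magic_labelling :: "nat \<Rightarrow> (nat \<Rightarrow> real^'n \<Rightarrow> real) \<Rightarrow> real^'n \<Rightarrow> bool" where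
  "magic_labelling m f x \<longleftrightarrow>
     (\<forall>j. x $ j \<in> \<int>) \<and> distinct_entries x \<and> (\<forall>j. 0 < x $ j) \<and>
     (\<forall>i\<in>{1..m}. \<forall>k\<in>{1..m}. f i x = f k x)"

definition realizes :: "real^'n::{finite,linorder} \<Rightarrow> ('n \<Rightarrow> 'n) \<Rightarrow> bool" where
  "realizes x \<tau> \<longleftrightarrow> strict_mono (\<lambda>i. x $ \<tau> i)"

definition compatible :: "real^'n::{finite,linorder} \<Rightarrow> ('n \<Rightarrow> 'n) \<Rightarrow> bool" where
  "compatible x \<sigma> \<longleftrightarrow> mono (\<lambda>i. x $ \<sigma> i)"

definition realizable_in :: "(real^'n::{finite,linorder}) set \<Rightarrow> ('n \<Rightarrow> 'n) \<Rightarrow> bool" where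
  "realizable_in R \<tau> \<longleftrightarrow> (\<exists>y\<in>R. realizes y \<tau>)"

definition strict_magic_count :: "nat \<Rightarrow> (nat \<Rightarrow> real^'n \<Rightarrow> real) \<Rightarrow> nat \<Rightarrow> nat" where
  "strict_magic_count m f t =
     card {x \<in> integer_points (dilate t (magic_polytope m f)).
             distinct_entries x \<and> (\<forall>j. 0 < x $ j)}"

definition weak_magic_count ::
    "nat \<Rightarrow> (nat \<Rightarrow> real^'n::{finite,linorder} \<Rightarrow> real) \<Rightarrow> nat \<Rightarrow> nat" where
  "weak_magic_count m f t =
     card {(x, \<sigma>). x \<in> integer_points (dilate t (magic_polytope m f)) \<and> (\<forall>j. 0 \<le> x $ j) \<and>
                   \<sigma> permutes UNIV \<and> compatible x \<sigma> \<and>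
                   realizable_in (rel_interior (magic_polytope m f)) \<sigma>}"

text \<open>Coefficients of mixed sign can make \<open>magic_polytope m f\<close> unbounded, and then the counts above
  may be infinite.  Nonnegative coefficients rule this out, because every variable appears.\<close>

lemma finite_integer_points_dilate:
  fixes X :: "(real^'n) set"
  assumes "bounded X"
  shows "finite (integer_points (dilate t X))"
proof -
  have "bounded (dilate t X)"
    unfolding dilate_def using assms by (rule bounded_scaling)
  then obtain B where B: "\<And>x. x \<in> dilate t X \<Longrightarrow> norm x \<le> B"
    unfolding bounded_iff by blast
  let ?C = "{k::real. k \<in> \<int> \<and> \<bar>k\<bar> \<le> B}"
  have "finite (PiE (UNIV::'n set) (\<lambda>_. ?C))"
    by (intro finite_PiE finite_abs_int_segment) auto
  moreover have "(\<lambda>x j. x $ j) ` integer_points (dilate t X) \<subseteq> PiE UNIV (\<lambda>_. ?C)"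
    unfolding integer_points_def using B component_le_norm_cart order_trans by fastforce
  ultimately have "finite ((\<lambda>x j. x $ j) ` integer_points (dilate t X))"
    using finite_subset by blast
  moreover have "inj_on (\<lambda>x j. x $ j) (integer_points (dilate t X))"
    by (auto simp: inj_on_def vec_eq_iff fun_eq_iff)
  ultimately show ?thesis
    by (rule finite_imageD)
qed

lemma bounded_magic_polytope:
  fixes f :: "nat \<Rightarrow> real^'n \<Rightarrow> real"
  assumes lin: "\<And>i. i \<in> {1..m} \<Longrightarrow> rational_linear_form (f i)"
    and nonneg: "\<And>i j. i \<in> {1..m} \<Longrightarrow> 0 \<le> f i (axis j 1)"
    and cover: "\<And>j. \<exists>i\<in>{1..m}. appears_in j (f i)"
  shows "bounded (magic_polytope m f)"
proof -
  have *: "\<exists>b. \<forall>x\<in>magic_polytope m f. \<bar>x $ j\<bar> \<le> b" for j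
  proof -
    obtain i where i: "i \<in> {1..m}" "f i (axis j 1) \<noteq> 0"
      using cover unfolding appears_in_def by blast
    with nonneg have pos: "0 < f i (axis j 1)"
      by (metis order_le_less)
    have "\<bar>x $ j\<bar> \<le> 1 / f i (axis j 1)" if x: "x \<in> magic_polytope m f" for x
    proof -
      have x0: "\<And>k. 0 \<le> x $ k" and x1: "f i x = 1"
        using x i unfolding magic_polytope_def orthant_def solution_space_def by auto
      have l: "linear (f i)"
        using lin i unfolding rational_linear_form_def by blast
      have "f i x = f i (\<Sum>k\<in>UNIV. x $ k *\<^sub>R axis k 1)"
        using basis_expansion[of x] by (simp add: scalar_mult_eq_scaleR)
      also have "\<dots> = (\<Sum>k\<in>UNIV. x $ k * f i (axis k 1))"
        using l by (simp add: linear_sum linear_cmul)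
      finally have "(\<Sum>k\<in>UNIV. x $ k * f i (axis k 1)) = 1"
        using x1 by simp
      moreover have "x $ j * f i (axis j 1) \<le> (\<Sum>k\<in>UNIV. x $ k * f i (axis k 1))"
        using x0 nonneg i by (intro member_le_sum) auto
      ultimately show ?thesis
        using pos x0[of j] by (simp add: field_simps)
    qed
    then show ?thesis by blast
  qed
  then obtain b where b: "\<And>j x. x \<in> magic_polytope m f \<Longrightarrow> \<bar>x $ j\<bar> \<le> b j"
    by metis
  have "norm x \<le> (\<Sum>j\<in>UNIV. b j)" if "x \<in> magic_polytope m f" for x
    using norm_le_l1_cart[of x] b[OF that] by (meson order_trans sum_mono)
  then show ?thesis
    unfolding bounded_iff by blast
qed

end

theory Submission
  imports Defs
begin

text \<open>A constant vector lies in the solution space and on every hyperplane \<open>x\<^sub>j = x\<^sub>k\<close>, and the magic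
  labelling, shifted along the diagonal, shows that no such hyperplane contains the solution space.
  Hence the poset is the lattice of flats of a central arrangement, and \<open>\<mu>(0,u)\<close> is the sum of
  \<open>(-1)\<^bsup>|S|\<^esup>\<close> over the sets \<open>S\<close> of hyperplanes cutting out \<open>u\<close>.  Exchanging summations
  reduces both formulas to a statement about a single point \<open>x\<close> and the set of hyperplanes
  through it.  The first becomes the vanishing of the alternating sum over the subsets of a nonempty
  set.  The second becomes Zaslavsky's theorem: the number of regions of a central arrangement is
  the sum of \<open>(-1)\<^bsup>|S| + codim S\<^esup>\<close> over all sets \<open>S\<close> of hyperplanes, which holds because both sides
  satisfy deletion-restriction; the same recursion shows that the part of this sum belonging to
  a fixed flat is nonnegative, so it is \<open>|\<mu>|\<close>.\<close>

section \<open>Small perturbations and alternating sums over subsets\<close>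

text \<open>Each \<open>e * d i\<close> tends to 0 with \<open>e\<close>, and finitely many bounds
  hold at once. This allows moving a point slightly without changing any nonzero sign.\<close>

lemma small_perturbation:
  fixes c d :: "'i \<Rightarrow> real"
  assumes "finite I" and "\<And>i. i \<in> I \<Longrightarrow> c i \<noteq> 0"
  obtains e where "0 < e" and "\<And>i. i \<in> I \<Longrightarrow> \<bar>e * d i\<bar> < \<bar>c i\<bar>"
proof -
  have "eventually (\<lambda>e. \<bar>e * d i\<bar> < \<bar>c i\<bar>) (at_right 0)" if "i \<in> I" for i
  proof -
    have "((\<lambda>e. \<bar>e * d i\<bar>) \<longlongrightarrow> \<bar>0 * d i\<bar>) (at_right 0)"
      by (intro tendsto_intros)
    then show ?thesis
      using assms(2)[OF that] by (auto intro: order_tendstoD)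
  qed
  then have "eventually (\<lambda>e. \<forall>i\<in>I. \<bar>e * d i\<bar> < \<bar>c i\<bar>) (at_right 0)"
    using assms(1) by (intro eventually_ball_finite) auto
  then have "eventually (\<lambda>e. 0 < e \<and> (\<forall>i\<in>I. \<bar>e * d i\<bar> < \<bar>c i\<bar>)) (at_right 0)"
    using eventually_at_right_less eventually_conj by blast
  then obtain e where "0 < e" "\<forall>i\<in>I. \<bar>e * d i\<bar> < \<bar>c i\<bar>"
    using eventually_happens'[OF trivial_limit_at_right_real] by blast
  then show thesis using that by blast
qed

lemma sum_Pow_insert:
  fixes g :: "'i set \<Rightarrow> 'b::comm_monoid_add"
  assumes "finite I" and "k \<notin> I"
  shows "sum g (Pow (insert k I)) = sum g (Pow I) + (\<Sum>S\<in>Pow I. g (insert k S))"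
proof -
  have "inj_on (insert k) (Pow I)"
    using assms(2) by (auto simp: inj_on_def)
  moreover have "Pow I \<inter> insert k ` Pow I = {}"
    using assms(2) by auto
  ultimately show ?thesis
    using assms(1) by (simp add: Pow_insert sum.union_disjoint sum.reindex)
qed

text \<open>For a fixed element \<open>k\<close> the terms of \<open>S\<close> and
  \<open>insert k S\<close> cancel.\<close>

lemma sum_Pow_neg_one_card:
  assumes "finite I"
  shows "(\<Sum>S\<in>Pow I. (-1) ^ card S) = (if I = {} then 1 else 0 :: int)"
proof (cases "I = {}")
  case False
  then obtain k J where J: "I = insert k J" "k \<notin> J"
    by (metis Set.set_insert ex_in_conv)
  then have fin: "finite J"
    using assms by simp
  have "(\<Sum>S\<in>Pow J. (-1::int) ^ card (insert k S)) = (\<Sum>S\<in>Pow J. - ((-1) ^ card S))"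
  proof (rule sum.cong)
    fix S assume "S \<in> Pow J"
    then have "k \<notin> S" "finite S"
      using J fin by (auto intro: finite_subset)
    then show "(-1::int) ^ card (insert k S) = - ((-1) ^ card S)"
      by simp
  qed simp
  then show ?thesis
    using J fin by (simp add: sum_Pow_insert sum_negf)
qed simp


section \<open>Moebius values of intersection posets\<close>

text \<open>Alternating sums over all defining subfamilies satisfy the recursion of the Moebius
  function, because the subfamilies whose intersection contains \<open>v\<close> form a Boolean lattice.\<close>

lemma mobius_intersection_poset:
  fixes H :: "'i \<Rightarrow> 'a set"
  assumes fin: "finite I" and proper: "\<And>i. i \<in> I \<Longrightarrow> \<not> R \<subseteq> H i"
    and u: "u \<in> intersection_poset R (H ` I)"
  shows "mobius (intersection_poset R (H ` I)) R u =
    (\<Sum>S | S \<subseteq> I \<and> R \<inter> \<Inter>(H ` S) = u. (-1) ^ card S)"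
proof -
  define L where "L = intersection_poset R (H ` I)"
  define Z where "Z S = R \<inter> \<Inter>(H ` S)" for S
  define \<nu> :: "'a set \<Rightarrow> int" where "\<nu> u = (\<Sum>S | S \<subseteq> I \<and> Z S = u. (-1) ^ card S)" for u
  have L: "L = Z ` Pow I - {{}}"
    unfolding L_def intersection_poset_def Z_def by (auto simp: subset_image_iff)
  then have finL: "finite L"
    using fin by simp
  have sub: "v \<subseteq> R" if "v \<in> L" for v
    using that L by (auto simp: Z_def)
  have RL: "R \<in> L"
  proof -
    have "Z {} = R" by (simp add: Z_def)
    moreover have "R \<noteq> {}"
      using u sub[of u] L by (auto simp: L_def)
    ultimately show ?thesis
      unfolding L by blast
  qed
  \<comment> \<open>A set \<open>S\<close> contributes to some \<open>w\<close> above
    \<open>v\<close> exactly when \<open>S \<subseteq> J\<close>; as \<open>v\<close> is nonempty,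
    each such \<open>Z S\<close> belongs to \<open>L\<close>. So the sum runs over a full power
    set.\<close>
  have up: "(\<Sum>w | w \<in> L \<and> v \<subseteq> w. \<nu> w) = (if v = R then 1 else 0)" if v: "v \<in> L" for v
  proof -
    define J where "J = {i \<in> I. v \<subseteq> H i}"
    have "(\<Sum>w | w \<in> L \<and> v \<subseteq> w. \<nu> w) =
        (\<Sum>w | w \<in> L \<and> v \<subseteq> w. \<Sum>S | S \<in> Pow J \<and> Z S = w. (-1) ^ card S)"
      unfolding \<nu>_def
    proof (intro sum.cong refl)
      fix w assume "w \<in> {w \<in> L. v \<subseteq> w}"
      then show "{S. S \<subseteq> I \<and> Z S = w} = {S. S \<in> Pow J \<and> Z S = w}"
        by (auto simp: J_def Z_def)
    qed
    also have "\<dots> = (\<Sum>S\<in>Pow J. (-1) ^ card S)"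
    proof (rule sum.group)
      show "finite (Pow J)" "finite {w \<in> L. v \<subseteq> w}"
        using fin finL by (auto simp: J_def)
      have "v \<noteq> {}" using v L by blast
      then show "Z ` Pow J \<subseteq> {w \<in> L. v \<subseteq> w}"
        using sub[OF v] unfolding L by (fastforce simp: J_def Z_def)
    qed
    also have "\<dots> = (if J = {} then 1 else 0)"
      using fin by (intro sum_Pow_neg_one_card) (simp add: J_def)
    \<comment> \<open>A family cutting out \<open>v\<close> lies inside \<open>J\<close>, so an
      empty \<open>J\<close> forces \<open>v = Z {} = R\<close>; conversely no \<open>H i\<close>
      contains \<open>R\<close>.\<close>
    also have "J = {} \<longleftrightarrow> v = R"
    proof
      assume J: "J = {}"
      obtain S where S: "S \<subseteq> I" "v = Z S" using v L by blast
      then have "S \<subseteq> J" by (auto simp: J_def Z_def)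
      then show "v = R" using S J by (simp add: Z_def)
    qed (use proper in \<open>auto simp: J_def\<close>)
    finally show ?thesis .
  qed
  \<comment> \<open>The identity \<open>up\<close> is the Moebius recursion, so both sides agree by
    induction on the number of members strictly above \<open>v\<close>.\<close>
  have "mobius L R v = \<nu> v" if "v \<in> L" for v
    using that
  proof (induction "card {w \<in> L. v \<subset> w}" arbitrary: v rule: less_induct)
    case less
    have split: "{w. w \<in> L \<and> v \<subseteq> w} = insert v {w \<in> L. v \<subset> w}"
      using less.prems by auto
    have rec: "\<nu> v + (\<Sum>w | w \<in> L \<and> v \<subset> w. \<nu> w) = (if v = R then 1 else 0)"
      using up[OF less.prems] finL unfolding split by simp
    show ?case
    proof (cases "v = R")
      case True
      then have "{w. w \<in> L \<and> v \<subset> w} = {}"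
        using sub by auto
      then have "\<nu> v = 1"
        using rec True by (metis add.right_neutral sum.empty)
      then show ?thesis
        using True RL finL by (simp add: mobius.simps)
    next
      case False
      then have "v \<subset> R"
        using sub less.prems by blast
      then have "mobius L R v = - (\<Sum>w\<in>{w\<in>L. v \<subset> w \<and> w \<subseteq> R}. mobius L R w)"
        using False finL RL less.prems by (subst mobius.simps) simp
      also have "{w\<in>L. v \<subset> w \<and> w \<subseteq> R} = {w \<in> L. v \<subset> w}"
        using sub by auto
      also have "(\<Sum>w\<in>{w \<in> L. v \<subset> w}. mobius L R w) = (\<Sum>w\<in>{w \<in> L. v \<subset> w}. \<nu> w)"
      proof (intro sum.cong refl less.hyps)
        fix w assume "w \<in> {w \<in> L. v \<subset> w}"
        then show "card {x \<in> L. w \<subset> x} < card {x \<in> L. v \<subset> x}" "w \<in> L"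
          using finL by (auto intro!: psubset_card_mono)
      qed
      finally show ?thesis
        using rec False by simp
    qed
  qed
  then show ?thesis
    using u unfolding L_def \<nu>_def Z_def by blast
qed


section \<open>Regions of a central arrangement\<close>

definition common_zeros :: "('i \<Rightarrow> 'a \<Rightarrow> real) \<Rightarrow> 'i set \<Rightarrow> 'a set" where
  "common_zeros a S = {x. \<forall>i\<in>S. a i x = 0}"

text \<open>A region is recorded by the set of indices whose form is positive on it.\<close>

definition sign_regions :: "'a set \<Rightarrow> ('i \<Rightarrow> 'a \<Rightarrow> real) \<Rightarrow> 'i set \<Rightarrow> 'i set set" where
  "sign_regions V a I =
     {T. T \<subseteq> I \<and> (\<exists>v\<in>V. (\<forall>i\<in>T. 0 < a i v) \<and> (\<forall>i\<in>I - T. a i v < 0))}"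

text \<open>The exponent has the parity of cardinality plus codimension in \<open>V\<close>; adding
  the two dimensions avoids subtraction of naturals.\<close>

definition whitney_term :: "'a::euclidean_space set \<Rightarrow> ('i \<Rightarrow> 'a \<Rightarrow> real) \<Rightarrow> 'i set \<Rightarrow> int" where
  "whitney_term V a S = (-1) ^ (card S + dim V + dim (V \<inter> common_zeros a S))"

lemma common_zeros_empty [simp]: "common_zeros a {} = UNIV"
  by (simp add: common_zeros_def)

lemma common_zeros_insert:
  "V \<inter> common_zeros a (insert k S) = (V \<inter> {x. a k x = 0}) \<inter> common_zeros a S"
  by (auto simp: common_zeros_def)

text \<open>Subtracting a multiple of \<open>v\<close> moves any point of \<open>V\<close> into the
  kernel, so the kernel and \<open>v\<close> together span \<open>V\<close>.\<close>

lemma dim_Int_kernel: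
  fixes g :: "'a::euclidean_space \<Rightarrow> real"
  assumes "linear g" and V: "subspace V" and v: "v \<in> V" "g v \<noteq> 0"
  shows "dim V = Suc (dim (V \<inter> {x. g x = 0}))"
proof -
  interpret linear g by fact
  let ?W = "V \<inter> {x. g x = 0}"
  have W: "subspace ?W"
    using V by (auto simp: subspace_def add scaleR)
  have "V \<subseteq> span (insert v ?W)"
  proof
    fix x assume x: "x \<in> V"
    have "x - (g x / g v) *\<^sub>R v \<in> ?W"
      using x v V by (auto simp: diff scaleR subspace_diff subspace_scale)
    then have "x - (g x / g v) *\<^sub>R v \<in> span ?W"
      by (rule span_base)
    then show "x \<in> span (insert v ?W)"
      by (auto simp: span_breakdown_eq)
  qed
  moreover have "insert v ?W \<subseteq> V"
    using v by auto
  ultimately have "dim V = dim (insert v ?W)"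
    by (metis dim_span dim_subset order_antisym)
  moreover have "v \<notin> span ?W"
    using W v by (simp add: span_eq_iff[THEN iffD2])
  ultimately show ?thesis
    by (simp add: dim_insert)
qed

text \<open>Restriction removes one index and lowers the ambient dimension by one, so the parity is
  unchanged.\<close>

lemma whitney_term_insert:
  assumes "linear (a k)" and "subspace V" and "v \<in> V" and "a k v \<noteq> 0"
    and "finite S" and "k \<notin> S"
  shows "whitney_term V a (insert k S) = whitney_term (V \<inter> {x. a k x = 0}) a S"
  unfolding whitney_term_def common_zeros_insert
  using assms by (simp add: dim_Int_kernel)

text \<open>The zero set stays the same and only the cardinality grows. The resulting cancellation
  matches the absence of regions when a form vanishes on \<open>V\<close>.\<close>

lemma whitney_term_insert_degenerate:
  assumes "\<forall>v\<in>V. a k v = 0" and "finite S" and "k \<notin> S"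
  shows "whitney_term V a (insert k S) = - whitney_term V a S"
proof -
  have "V \<inter> {x. a k x = 0} = V"
    using assms(1) by auto
  then show ?thesis
    using assms unfolding whitney_term_def common_zeros_insert by simp
qed

text \<open>\<open>pos\<close> and \<open>neg\<close> are the sign patterns on \<open>I\<close>
  occurring on either side of hyperplane \<open>k\<close>. Their union consists of the regions
  without \<open>k\<close>, and their intersection of the regions cut by the hyperplane, which are
  those of the restriction.\<close>

lemma card_sign_regions_insert:
  fixes a :: "'i \<Rightarrow> 'a::real_vector \<Rightarrow> real"
  assumes fin: "finite I" and k: "k \<notin> I"
    and lin: "\<And>i. i \<in> insert k I \<Longrightarrow> linear (a i)"
    and V: "subspace V" and v0: "v0 \<in> V" "a k v0 \<noteq> 0"
  shows "card (sign_regions V a (insert k I)) =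
    card (sign_regions V a I) + card (sign_regions (V \<inter> {x. a k x = 0}) a I)"
proof -
  define pos where "pos = {T. T \<subseteq> I \<and> insert k T \<in> sign_regions V a (insert k I)}"
  define neg where "neg = {T. T \<subseteq> I \<and> T \<in> sign_regions V a (insert k I)}"
  have add: "a i (x + r *\<^sub>R y) = a i x + r * a i y" if "i \<in> insert k I" for i x y r
    using lin[OF that] by (simp add: linear_add linear_cmul)
  have posD: "\<exists>v\<in>V. (\<forall>i\<in>T. 0 < a i v) \<and> (\<forall>i\<in>I - T. a i v < 0) \<and> 0 < a k v"
    if "T \<in> pos" for T
    using that k unfolding pos_def sign_regions_def by (auto simp: insert_Diff_if)
  have posI: "T \<in> pos"
    if "T \<subseteq> I" "v \<in> V" "\<forall>i\<in>T. 0 < a i v" "\<forall>i\<in>I - T. a i v < 0" "0 < a k v" for T v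
    using that k unfolding pos_def sign_regions_def by auto
  have negD: "\<exists>v\<in>V. (\<forall>i\<in>T. 0 < a i v) \<and> (\<forall>i\<in>I - T. a i v < 0) \<and> a k v < 0"
    if "T \<in> neg" for T
    using that k unfolding neg_def sign_regions_def by blast
  have negI: "T \<in> neg"
    if "T \<subseteq> I" "v \<in> V" "\<forall>i\<in>T. 0 < a i v" "\<forall>i\<in>I - T. a i v < 0" "a k v < 0" for T v
    using that k unfolding neg_def sign_regions_def by auto
  have sub: "pos \<subseteq> Pow I" "neg \<subseteq> Pow I"
    by (auto simp: pos_def neg_def)
  then have fin2: "finite pos" "finite neg"
    using fin by (auto intro: finite_subset)

  have "sign_regions V a (insert k I) = insert k ` pos \<union> neg"
  proof
    show "sign_regions V a (insert k I) \<subseteq> insert k ` pos \<union> neg"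
    proof
      fix T assume T: "T \<in> sign_regions V a (insert k I)"
      show "T \<in> insert k ` pos \<union> neg"
      proof (cases "k \<in> T")
        case True
        then have T': "insert k (T - {k}) = T" by auto
        have "T - {k} \<subseteq> I"
          using T by (auto simp: sign_regions_def)
        then have "T - {k} \<in> pos"
          using T unfolding pos_def T' mem_Collect_eq by simp
        then show ?thesis using T' by blast
      qed (use T in \<open>auto simp: neg_def sign_regions_def\<close>)
    qed
  qed (auto simp: pos_def neg_def)
  moreover have "card (insert k ` pos) = card pos"
    using sub k by (intro card_image inj_onI) (metis PowD insert_ident subsetD)
  moreover have "insert k ` pos \<inter> neg = {}"
    using sub k by auto
  ultimately have "card (sign_regions V a (insert k I)) = card pos + card neg"
    using fin2 by (simp add: card_Un_disjoint)
  also have "\<dots> = card (pos \<union> neg) + card (pos \<inter> neg)"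
    using fin2 by (rule card_Un_Int)
  finally have total: "card (sign_regions V a (insert k I)) = card (pos \<union> neg) + card (pos \<inter> neg)" .
  \<comment> \<open>A point on the hyperplane is pushed to both sides along \<open>w\<close>, where
    \<open>a k w = 1\<close>, by so little that the signs on \<open>I\<close> survive.\<close>
  have perturb: "T \<in> pos \<inter> neg"
    if T: "T \<subseteq> I" and v: "v \<in> V" "a k v = 0" "\<forall>i\<in>T. 0 < a i v" "\<forall>i\<in>I - T. a i v < 0"
    for T v
  proof -
    define w where "w = (1 / a k v0) *\<^sub>R v0"
    have w: "w \<in> V" "a k w = 1"
      using v0 V lin[of k] by (auto simp: w_def subspace_scale linear_cmul)
    have "\<And>i. i \<in> I \<Longrightarrow> a i v \<noteq> 0"
      using v by (metis DiffI less_irrefl)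
    then obtain e where e: "0 < e" "\<And>i. i \<in> I \<Longrightarrow> \<bar>e * a i w\<bar> < \<bar>a i v\<bar>"
      using small_perturbation[of I "\<lambda>i. a i v" "\<lambda>i. a i w"] fin by metis
    have signs: "0 < a i v + e * a i w" "0 < a i v - e * a i w" if "i \<in> T" for i
      using e(2)[of i] v(3) T that by force+
    have signs': "a i v + e * a i w < 0" "a i v - e * a i w < 0" if "i \<in> I - T" for i
      using e(2)[of i] v(4) T that by force+
    have "T \<in> pos"
      using T e(1) v w V signs signs'
      by (intro posI[of _ "v + e *\<^sub>R w"]) (auto simp: add subset_iff subspace_add subspace_scale)
    moreover have "a i (v - e *\<^sub>R w) = a i v - e * a i w" if "i \<in> insert k I" for i
      using add[OF that, of v "-e" w] by simp
    then have "T \<in> neg"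
      using T e(1) v w V signs signs'
      by (intro negI[of _ "v - e *\<^sub>R w"]) (auto simp: subset_iff subspace_diff subspace_scale)
    ultimately show ?thesis by blast
  qed
  have "pos \<union> neg = sign_regions V a I"
  proof
    show "pos \<union> neg \<subseteq> sign_regions V a I"
    proof
      fix T assume T: "T \<in> pos \<union> neg"
      then have "T \<subseteq> I" using sub by blast
      moreover obtain v where "v \<in> V" "\<forall>i\<in>T. 0 < a i v" "\<forall>i\<in>I - T. a i v < 0"
        using T posD[of T] negD[of T] by auto
      ultimately show "T \<in> sign_regions V a I"
        unfolding sign_regions_def by blast
    qed
    show "sign_regions V a I \<subseteq> pos \<union> neg"
    proof
      fix T assume "T \<in> sign_regions V a I"
      then obtain v where v: "T \<subseteq> I" "v \<in> V" "\<forall>i\<in>T. 0 < a i v" "\<forall>i\<in>I - T. a i v < 0"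
        unfolding sign_regions_def by blast
      consider "a k v < 0" | "a k v = 0" | "0 < a k v" by linarith
      then show "T \<in> pos \<union> neg"
        using negI[OF v] perturb[OF v(1,2) _ v(3,4)] posI[OF v] by cases auto
    qed
  qed
  moreover have "pos \<inter> neg = sign_regions (V \<inter> {x. a k x = 0}) a I"
  proof
    show "sign_regions (V \<inter> {x. a k x = 0}) a I \<subseteq> pos \<inter> neg"
    proof
      fix T assume "T \<in> sign_regions (V \<inter> {x. a k x = 0}) a I"
      then obtain v where "T \<subseteq> I" "v \<in> V" "a k v = 0" "\<forall>i\<in>T. 0 < a i v" "\<forall>i\<in>I - T. a i v < 0"
        unfolding sign_regions_def by blast
      then show "T \<in> pos \<inter> neg" by (rule perturb)
    qed
    show "pos \<inter> neg \<subseteq> sign_regions (V \<inter> {x. a k x = 0}) a I"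
    proof
      fix T assume T: "T \<in> pos \<inter> neg"
      obtain v where v: "v \<in> V" "\<forall>i\<in>T. 0 < a i v" "\<forall>i\<in>I - T. a i v < 0" "0 < a k v"
        using posD[of T] T by auto
      obtain w where w: "w \<in> V" "\<forall>i\<in>T. 0 < a i w" "\<forall>i\<in>I - T. a i w < 0" "a k w < 0"
        using negD[of T] T by auto
      \<comment> \<open>Up to a positive factor \<open>z\<close> is the point where the segment from
        \<open>v\<close> to \<open>w\<close> crosses the hyperplane; a positive combination keeps
        the common signs.\<close>
      define z where "z = v + (a k v / - a k w) *\<^sub>R w"
      define r where "r = a k v / - a k w"
      have r: "0 < r" using v w by (simp add: r_def divide_pos_neg)
      have z: "a i z = a i v + r * a i w" if "i \<in> insert k I" for i
        unfolding z_def r_def by (rule add[OF that])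
      have "a k z = 0"
        using z[of k] w by (simp add: r_def)
      moreover have "z \<in> V"
        using v w V unfolding z_def by (intro subspace_add subspace_scale)
      moreover have TI: "T \<subseteq> I" using T sub by blast
      moreover have "0 < a i z" if "i \<in> T" for i
        using z[of i] that subsetD[OF TI that] r v w by (auto intro!: add_pos_pos mult_pos_pos)
      moreover have "a i z < 0" if "i \<in> I - T" for i
        using z[of i] that r v w by (auto intro!: add_neg_neg mult_pos_neg)
      ultimately show "T \<in> sign_regions (V \<inter> {x. a k x = 0}) a I"
        unfolding sign_regions_def by blast
    qed
  qed
  ultimately show ?thesis
    using total by simp
qed

lemma subspace_Int_kernel:
  assumes "linear g" and "subspace V"
  shows "subspace (V \<inter> {x. g x = 0})"
  using assms linear_subspace_kernel subspace_Int by (metis subspace_inter)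

text \<open>Both sides satisfy the same deletion-restriction recursion.\<close>

theorem card_sign_regions:
  fixes a :: "'i \<Rightarrow> 'a::euclidean_space \<Rightarrow> real"
  assumes "finite I" and "\<And>i. i \<in> I \<Longrightarrow> linear (a i)" and "subspace V"
  shows "int (card (sign_regions V a I)) = (\<Sum>S\<in>Pow I. whitney_term V a S)"
  using assms
proof (induction I arbitrary: V rule: finite_induct)
  case empty
  have "sign_regions V a {} = {{}}"
    using subspace_0[OF empty(2)] by (auto simp: sign_regions_def)
  then show ?case by (simp add: whitney_term_def flip: mult_2)
next
  case (insert k I)
  have S: "finite S" "k \<notin> S" if "S \<in> Pow I" for S
    using that insert.hyps by (auto intro: finite_subset)
  show ?case
  proof (cases "\<forall>v\<in>V. a k v = 0")
    case True
    have "sign_regions V a (insert k I) = {}"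
      using True unfolding sign_regions_def by force
    then show ?thesis
      using S insert.hyps True
      by (simp add: sum_Pow_insert whitney_term_insert_degenerate sum_negf)
  next
    case False
    then obtain v where v: "v \<in> V" "a k v \<noteq> 0" by blast
    have "card (sign_regions V a (insert k I)) =
        card (sign_regions V a I) + card (sign_regions (V \<inter> {x. a k x = 0}) a I)"
      using insert.hyps insert.prems v by (intro card_sign_regions_insert)
    then show ?thesis
      using S insert.hyps insert.prems v
      by (simp add: sum_Pow_insert whitney_term_insert[of a k V v] insert.IH subspace_Int_kernel)
  qed
qed

text \<open>Deletion-restriction respects the target \<open>F\<close>, which stays fixed while
  \<open>V\<close> shrinks to the hyperplane. In the degenerate case the terms cancel to 0;
  otherwise the sum splits into two nonnegative ones.\<close>

theorem whitney_sum_nonneg: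
  fixes a :: "'i \<Rightarrow> 'a::euclidean_space \<Rightarrow> real"
  assumes "finite I" and "\<And>i. i \<in> I \<Longrightarrow> linear (a i)" and "subspace V"
  shows "0 \<le> (\<Sum>S | S \<subseteq> I \<and> V \<inter> common_zeros a S = F. whitney_term V a S)"
proof -
  have "0 \<le> (\<Sum>S\<in>Pow I. if V \<inter> common_zeros a S = F then whitney_term V a S else 0)"
    using assms
  proof (induction I arbitrary: V rule: finite_induct)
    case empty
    then show ?case by (cases "V = F") (simp_all add: whitney_term_def flip: mult_2)
  next
    case (insert k I)
    have S: "finite S" "k \<notin> S" if "S \<in> Pow I" for S
      using that insert.hyps by (auto intro: finite_subset)
    show ?case
    proof (cases "\<forall>v\<in>V. a k v = 0")
      case True
      then have "V \<inter> {x. a k x = 0} = V" by auto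
      then have "(\<Sum>S\<in>Pow I. if V \<inter> common_zeros a (insert k S) = F
            then whitney_term V a (insert k S) else 0) =
          (\<Sum>S\<in>Pow I. - (if V \<inter> common_zeros a S = F then whitney_term V a S else 0))"
        using S True
        by (intro sum.cong refl) (simp add: common_zeros_insert whitney_term_insert_degenerate)
      then show ?thesis
        using insert.hyps by (simp add: sum_Pow_insert sum_negf)
    next
      case False
      then obtain v where v: "v \<in> V" "a k v \<noteq> 0" by blast
      let ?W = "V \<inter> {x. a k x = 0}"
      have "(\<Sum>S\<in>Pow I. if V \<inter> common_zeros a (insert k S) = F
            then whitney_term V a (insert k S) else 0) =
          (\<Sum>S\<in>Pow I. if ?W \<inter> common_zeros a S = F then whitney_term ?W a S else 0)"
        using S v insert.prems
        by (intro sum.cong refl) (simp add: common_zeros_insert whitney_term_insert[of a k V v])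
      then show ?thesis
        using insert.hyps insert.prems insert.IH[of V] insert.IH[of ?W]
        by (simp add: sum_Pow_insert subspace_Int_kernel)
    qed
  qed
  also have "\<dots> = (\<Sum>S | S \<in> Pow I \<and> V \<inter> common_zeros a S = F. whitney_term V a S)"
    by (rule sum.inter_filter[symmetric]) (simp add: assms(1))
  finally show ?thesis by simp
qed


section \<open>Orderings of the coordinates\<close>

text \<open>The sets of smaller elements are nested, so this rank orders indices as \<open>g\<close>
  does.\<close>

lemma card_less_less_iff:
  fixes g :: "'a::finite \<Rightarrow> 'b::linorder"
  shows "card {k. g k < g i} < card {k. g k < g j} \<longleftrightarrow> g i < g j"
proof
  assume "g i < g j"
  then have "{k. g k < g i} \<subset> {k. g k < g j}"
    by (auto intro: less_trans)
  then show "card {k. g k < g i} < card {k. g k < g j}"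
    by (intro psubset_card_mono) auto
next
  assume less: "card {k. g k < g i} < card {k. g k < g j}"
  show "g i < g j"
  proof (rule ccontr)
    assume "\<not> g i < g j"
    then have "{k. g k < g j} \<subseteq> {k. g k < g i}"
      by auto
    then have "card {k. g k < g j} \<le> card {k. g k < g i}"
      by (intro card_mono) auto
    with less show False by simp
  qed
qed

lemma bij_betw_card_less:
  fixes g :: "'a::finite \<Rightarrow> 'b::linorder"
  assumes "inj g"
  shows "bij_betw (\<lambda>i. card {k. g k < g i}) UNIV {..<CARD('a)}"
proof -
  let ?r = "\<lambda>i. card {k. g k < g i}"
  have inj: "inj ?r"
  proof (rule injI)
    fix i j assume "?r i = ?r j"
    then have "g i = g j"
      using card_less_less_iff[of g i j] card_less_less_iff[of g j i] by force
    then show "i = j"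
      using assms by (simp add: inj_eq)
  qed
  have "?r i < CARD('a)" for i
    by (intro psubset_card_mono) auto
  then have "range ?r \<subseteq> {..<CARD('a)}"
    by auto
  then have "range ?r = {..<CARD('a)}"
    using inj by (intro card_subset_eq) (auto simp: card_image)
  with inj show ?thesis
    by (simp add: bij_betw_def)
qed

text \<open>The permutation sends each index to the coordinate whose rank in \<open>y\<close> equals
  the rank of that index.\<close>

lemma realizing_permutation_exists:
  fixes y :: "real^'n::{finite,linorder}"
  assumes "distinct_entries y"
  obtains \<sigma> where "\<sigma> permutes UNIV" and "realizes y \<sigma>"
proof -
  define r where "r i = card {k. y $ k < y $ i}" for i
  define q where "q i = card {k. k < i}" for i :: 'n
  have r: "bij_betw r UNIV {..<CARD('n)}"
    unfolding r_def using assms unfolding distinct_entries_def by (rule bij_betw_card_less)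
  have q: "bij_betw q UNIV {..<CARD('n)}"
    unfolding q_def using bij_betw_card_less[of "\<lambda>i::'n. i"] by simp
  define \<sigma> where "\<sigma> = inv_into UNIV r \<circ> q"
  have "bij \<sigma>"
    unfolding \<sigma>_def using bij_betw_trans[OF q bij_betw_inv_into[OF r]] .
  then have "\<sigma> permutes UNIV"
    by (intro bij_imp_permutes) auto
  moreover have rs: "r (\<sigma> i) = q i" for i
    unfolding \<sigma>_def comp_def
    by (intro f_inv_into_f) (metis bij_betw_imp_surj_on q r rangeI)
  have "y $ \<sigma> i < y $ \<sigma> j" if "i < j" for i j
  proof -
    have "q i < q j"
      unfolding q_def using card_less_less_iff[of "\<lambda>i::'n. i"] that by blast
    then have "r (\<sigma> i) < r (\<sigma> j)" by (simp add: rs)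
    then show ?thesis
      unfolding r_def by (rule card_less_less_iff[THEN iffD1])
  qed
  then have "realizes y \<sigma>"
    unfolding realizes_def by (simp add: strict_mono_def)
  ultimately show thesis using that by blast
qed

text \<open>\<open>inv \<sigma> k\<close> is the position of coordinate \<open>k\<close> in the
  ordering, and the number of coordinates placed before \<open>k\<close> determines it.\<close>

lemma permutation_eqI_inv_less:
  fixes \<sigma> \<tau> :: "'n::{finite,linorder} \<Rightarrow> 'n"
  assumes \<sigma>: "\<sigma> permutes UNIV" and \<tau>: "\<tau> permutes UNIV"
    and same: "\<And>j k. inv \<sigma> j < inv \<sigma> k \<longleftrightarrow> inv \<tau> j < inv \<tau> k"
  shows "\<sigma> = \<tau>"
proof -
  have rank: "card {j. inv \<rho> j < inv \<rho> k} = card {i. i < inv \<rho> k}"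
    if "\<rho> permutes UNIV" for \<rho> :: "'n \<Rightarrow> 'n" and k
  proof -
    have "bij (inv \<rho>)" using that by (simp add: permutes_bij bij_imp_bij_inv)
    then have "bij_betw (inv \<rho>) {j. inv \<rho> j < inv \<rho> k} {i. i < inv \<rho> k}"
      by (auto simp: bij_betw_def inj_on_def bij_def image_iff)
    then show ?thesis by (rule bij_betw_same_card)
  qed
  have "inv \<sigma> k = inv \<tau> k" for k
  proof -
    have "card {i. i < inv \<sigma> k} = card {i. i < inv \<tau> k}"
      using rank[OF \<sigma>, of k] rank[OF \<tau>, of k] same by simp
    then show ?thesis
      using card_less_less_iff[of "\<lambda>i::'n. i"] by (metis linorder_neqE less_irrefl)
  qed
  then have "inv \<sigma> = inv \<tau>" by auto
  then show ?thesis
    using \<sigma> \<tau> by (metis permutes_inv_inv)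
qed

lemma realizes_less_iff:
  assumes "\<sigma> permutes UNIV" and "realizes y \<sigma>"
  shows "inv \<sigma> j < inv \<sigma> k \<longleftrightarrow> y $ j < y $ k"
  using strict_mono_less[OF assms(2)[unfolded realizes_def], of "inv \<sigma> j" "inv \<sigma> k"]
  by (simp add: permutes_inverses[OF assms(1)])

lemma compatible_lessD:
  assumes "\<sigma> permutes UNIV" and "compatible y \<sigma>" and "y $ j < y $ k"
  shows "inv \<sigma> j < inv \<sigma> k"
proof (rule ccontr)
  assume "\<not> inv \<sigma> j < inv \<sigma> k"
  then have "inv \<sigma> k \<le> inv \<sigma> j" by simp
  then have "y $ \<sigma> (inv \<sigma> k) \<le> y $ \<sigma> (inv \<sigma> j)"
    using assms(2) unfolding compatible_def by (rule monoD[rotated])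
  then show False
    using assms(3) by (simp add: permutes_inverses[OF assms(1)])
qed


section \<open>Affine slices of the braid arrangement through a point of the diagonal\<close>

text \<open>Each hyperplane is indexed twice, by \<open>(j, k)\<close> and \<open>(k, j)\<close>.
  This is harmless, since the alternating sums and the region count above admit families with
  repetitions.\<close>

definition off_diagonal :: "('n \<times> 'n) set" where
  "off_diagonal = {(j, k). j \<noteq> k}"

definition coord_diff :: "'n \<times> 'n \<Rightarrow> real^'n \<Rightarrow> real" where
  "coord_diff = (\<lambda>(j, k) x. x $ j - x $ k)"

definition ties :: "real^'n \<Rightarrow> ('n \<times> 'n) set" where
  "ties x = {i \<in> off_diagonal. coord_diff i x = 0}"

lemma linear_coord_diff: "linear (coord_diff i)"
  by (cases i) (auto simp: coord_diff_def intro!: linearI simp: algebra_simps)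

lemma finite_off_diagonal: "finite (off_diagonal :: ('n::finite \<times> 'n) set)"
  by simp

lemma ties_subset: "ties x \<subseteq> off_diagonal"
  by (auto simp: ties_def)

lemma mem_common_zeros_coord_diff:
  "S \<subseteq> off_diagonal \<Longrightarrow> x \<in> common_zeros coord_diff S \<longleftrightarrow> S \<subseteq> ties x"
  by (auto simp: common_zeros_def ties_def)

lemma ties_empty_iff: "ties x = {} \<longleftrightarrow> distinct_entries x"
  by (auto simp: ties_def off_diagonal_def coord_diff_def distinct_entries_def inj_def)

lemma ties_scaleR: "r \<noteq> 0 \<Longrightarrow> ties (r *\<^sub>R x) = ties x"
  by (auto simp: ties_def linear_cmul[OF linear_coord_diff])

lemma coord_diff_constant [simp]: "coord_diff i (\<chi> j. q) = 0"
  by (cases i) (simp add: coord_diff_def)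

lemma coord_diff_add_scaleR:
  "coord_diff i (x + r *\<^sub>R y) = coord_diff i x + r * coord_diff i y"
  by (simp add: linear_add linear_cmul linear_coord_diff)

lemma coord_diff_diff: "coord_diff i (x - y) = coord_diff i x - coord_diff i y"
  by (simp add: linear_diff linear_coord_diff)

lemma interior_orthant: "interior (orthant :: (real^'n) set) = open_orthant"
proof
  show "interior orthant \<subseteq> (open_orthant :: (real^'n) set)"
  proof
    fix x :: "real^'n" assume x: "x \<in> interior orthant"
    have "0 < x $ j" for j
    proof -
      have "interior orthant \<subseteq> interior {x :: real^'n. x $ j \<ge> 0}"
        by (intro interior_mono) (auto simp: orthant_def)
      then show ?thesis using x by auto
    qed
    then show "x \<in> open_orthant" by (simp add: open_orthant_def)
  qed
  have "open (open_orthant :: (real^'n) set)"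
  proof -
    have eq: "open_orthant = (\<Inter>j. {x :: real^'n. 0 < x $ j})"
      by (auto simp: open_orthant_def)
    show ?thesis
      unfolding eq by (intro open_INT ballI open_Collect_less continuous_intros) simp
  qed
  then show "(open_orthant :: (real^'n) set) \<subseteq> interior orthant"
    by (intro interior_maximal) (auto simp: open_orthant_def orthant_def less_imp_le)
qed

lemma convex_orthant: "convex (orthant :: (real^'n) set)"
  by (auto simp: convex_def orthant_def)

text \<open>\<open>V\<close> is the direction space of the slice, and the constant vector with
  entries \<open>q\<close> is its diagonal point. The direction \<open>z\<close> leaves every
  hyperplane, so none contains the slice.\<close>

locale diagonal_slice =
  fixes V :: "(real^'n::{finite,linorder}) set" and q :: real
    and z :: "real^'n::{finite,linorder}"
  assumes V: "subspace V" and q: "0 < q" and z: "z \<in> V" "distinct_entries z"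
begin

abbreviation diag :: "(real, 'n) vec" where "diag \<equiv> \<chi> j. q"

definition slice :: "((real, 'n) vec) set" where "slice = {x. x - diag \<in> V}"

definition region :: "((real, 'n) vec) set" where "region = open_orthant \<inter> slice"

definition flat :: "('n \<times> 'n) set \<Rightarrow> ((real, 'n) vec) set" where
  "flat S = slice \<inter> common_zeros coord_diff S"

abbreviation poset :: "((real, 'n) vec) set set" where
  "poset \<equiv> intersection_poset region (induced_arrangement slice)"

lemma affine_slice: "affine slice"
proof -
  have "slice = (+) diag ` V"
    unfolding slice_def by (force simp: image_iff algebra_simps)
  then show ?thesis
    using V by (metis affine_translation subspace_imp_affine)
qed

lemma diag_mem: "diag \<in> slice" "diag \<in> open_orthant"
  using V q by (auto simp: slice_def open_orthant_def subspace_0)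

text \<open>The diagonal point lies in both relative interiors, so taking relative interiors
  commutes with the intersection.\<close>

lemma rel_interior_slice_orthant: "rel_interior (slice \<inter> orthant) = region"
proof -
  have "diag \<in> interior orthant"
    unfolding interior_orthant by (rule diag_mem)
  then have "rel_interior orthant = (open_orthant :: ((real, 'n) vec) set)"
    by (metis empty_iff interior_orthant rel_interior_nonempty_interior)
  moreover have "rel_interior slice = slice"
    using affine_slice by (rule rel_interior_affine)
  ultimately have "rel_interior (slice \<inter> orthant) = slice \<inter> open_orthant"
    using convex_rel_interior_inter_two[of slice orthant] affine_slice diag_mem
      convex_orthant affine_imp_convex by blast
  then show ?thesis
    by (auto simp: region_def)
qed

text \<open>Contracting towards the diagonal point keeps the order of the coordinates, and all flats
  pass through that point.\<close>

lemma contract_into_region: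
  assumes "y \<in> slice"
  obtains d where "0 < d" and "diag + d *\<^sub>R (y - diag) \<in> region"
proof -
  obtain d where d: "0 < d" "\<And>j. \<bar>d * (y $ j - q)\<bar> < \<bar>q\<bar>"
    using small_perturbation[of UNIV "\<lambda>_. q" "\<lambda>j. y $ j - q"] q by auto
  have "0 < q + d * (y $ j - q)" for j
    using d(2)[of j] q by linarith
  then have "diag + d *\<^sub>R (y - diag) \<in> open_orthant"
    by (simp add: open_orthant_def)
  moreover have "diag + d *\<^sub>R (y - diag) \<in> slice"
    using assms V by (simp add: slice_def subspace_scale)
  ultimately show thesis
    using that d(1) by (simp add: region_def)
qed

lemma coord_diff_contract:
  "coord_diff i (diag + d *\<^sub>R (y - diag)) = d * coord_diff i y"
  by (simp add: coord_diff_add_scaleR coord_diff_diff)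

lemma region_distinct: obtains y where "y \<in> region" and "distinct_entries y"
proof -
  have "diag + z \<in> slice" using z by (simp add: slice_def)
  then obtain d where d: "0 < d" "diag + d *\<^sub>R (diag + z - diag) \<in> region"
    by (rule contract_into_region)
  have "ties (diag + d *\<^sub>R (diag + z - diag)) = ties z"
    using d(1) by (auto simp: ties_def coord_diff_add_scaleR)
  then show thesis
    using that d(2) z(2) by (metis ties_empty_iff)
qed

text \<open>A point of the region with distinct entries shows that no pair
  \<open>j \<noteq> k\<close> is excluded.\<close>

lemma induced_arrangement_slice:
  "induced_arrangement slice = (\<lambda>(j, k). hyperplane_eq j k \<inter> slice) ` off_diagonal"
proof -
  obtain y where "y \<in> region" "distinct_entries y"
    by (rule region_distinct)
  then have "\<not> slice \<subseteq> hyperplane_eq j k" if "j \<noteq> k" for j k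
    using that by (auto simp: region_def hyperplane_eq_def distinct_entries_def inj_eq)
  then have "induced_arrangement slice = {hyperplane_eq j k \<inter> slice |j k. j \<noteq> k}"
    unfolding induced_arrangement_def by blast
  also have "\<dots> = (\<lambda>(j, k). hyperplane_eq j k \<inter> slice) ` off_diagonal"
    by (force simp: off_diagonal_def)
  finally show ?thesis .
qed

lemma flat_eq_Inter: "flat S = slice \<inter> \<Inter>((\<lambda>(j, k). hyperplane_eq j k \<inter> slice) ` S)"
  by (auto simp: flat_def common_zeros_def hyperplane_eq_def coord_diff_def)

lemma region_Inter_eq:
  "region \<inter> \<Inter>((\<lambda>(j, k). hyperplane_eq j k \<inter> slice) ` S) = region \<inter> flat S"
  unfolding flat_eq_Inter by (auto simp: region_def)

text \<open>Any point of \<open>flat S\<close> contracts into the region without leaving the flat.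
  Hence a trace on the region determines its flat, which makes \<open>flat_of\<close> well
  defined.\<close>

lemma region_flat_subsetD:
  assumes "region \<inter> flat S \<subseteq> region \<inter> flat T"
  shows "flat S \<subseteq> flat T"
proof
  fix y assume y: "y \<in> flat S"
  then have "y \<in> slice" by (simp add: flat_def)
  then obtain d where d: "0 < d" "diag + d *\<^sub>R (y - diag) \<in> region"
    by (rule contract_into_region)
  then have "diag + d *\<^sub>R (y - diag) \<in> region \<inter> flat S"
    using y by (auto simp: flat_def region_def common_zeros_def coord_diff_contract)
  then have "diag + d *\<^sub>R (y - diag) \<in> flat T" using assms by blast
  then show "y \<in> flat T"
    using y d(1) by (auto simp: flat_def common_zeros_def coord_diff_contract)
qed

lemma region_flat_eq_iff: "region \<inter> flat S = region \<inter> flat T \<longleftrightarrow> flat S = flat T"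
  using region_flat_subsetD[of S T] region_flat_subsetD[of T S] by blast

text \<open>Translation by the diagonal point turns flats into subspaces of \<open>V\<close>, whose
  dimensions enter \<open>whitney_term\<close>.\<close>

lemma flat_eq_iff:
  "flat S = flat T \<longleftrightarrow> V \<inter> common_zeros coord_diff S = V \<inter> common_zeros coord_diff T"
proof -
  have "flat S = (+) diag ` (V \<inter> common_zeros coord_diff S)" for S
  proof
    show "flat S \<subseteq> (+) diag ` (V \<inter> common_zeros coord_diff S)"
    proof
      fix x assume "x \<in> flat S"
      then have "x - diag \<in> V \<inter> common_zeros coord_diff S"
        by (auto simp: flat_def slice_def common_zeros_def coord_diff_diff)
      then show "x \<in> (+) diag ` (V \<inter> common_zeros coord_diff S)"
        by (rule rev_image_eqI) simp
    qed
  qed (auto simp: flat_def slice_def common_zeros_def linear_add[OF linear_coord_diff])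
  then show ?thesis
    by (simp add: inj_image_eq_iff)
qed

lemma flat_of_eq:
  assumes "S \<subseteq> off_diagonal"
  shows "flat_of slice region (induced_arrangement slice) (region \<inter> flat S) = flat S"
  unfolding flat_of_def induced_arrangement_slice
proof (rule the_equality)
  show "\<exists>\<S>\<subseteq>(\<lambda>(j, k). hyperplane_eq j k \<inter> slice) ` off_diagonal.
      flat S = slice \<inter> \<Inter>\<S> \<and> region \<inter> flat S = region \<inter> flat S"
    by (intro exI[of _ "(\<lambda>(j, k). hyperplane_eq j k \<inter> slice) ` S"] conjI image_mono assms
        flat_eq_Inter refl)
next
  fix F
  assume "\<exists>\<S>\<subseteq>(\<lambda>(j, k). hyperplane_eq j k \<inter> slice) ` off_diagonal.
      F = slice \<inter> \<Inter>\<S> \<and> region \<inter> F = region \<inter> flat S"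
  then obtain T where "F = slice \<inter> \<Inter>((\<lambda>(j, k). hyperplane_eq j k \<inter> slice) ` T)"
      and "region \<inter> F = region \<inter> flat S"
    unfolding subset_image_iff by auto
  then show "F = flat S"
    using region_flat_eq_iff[of T S] by (simp add: flat_eq_Inter)
qed

text \<open>The diagonal point lies in the region and in every flat, so no trace is empty.\<close>

lemma poset_eq: "poset = (\<lambda>S. region \<inter> flat S) ` Pow off_diagonal"
proof -
  have "diag \<in> region \<inter> flat S" for S
    using diag_mem by (simp add: region_def flat_def common_zeros_def)
  then have "{} \<notin> (\<lambda>S. region \<inter> flat S) ` Pow off_diagonal" by blast
  moreover have "{region \<inter> \<Inter>\<S> |\<S>. \<S> \<subseteq> induced_arrangement slice} =
      (\<lambda>S. region \<inter> flat S) ` Pow off_diagonal"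
    unfolding induced_arrangement_slice
    by (auto simp: subset_image_iff region_Inter_eq image_iff) (metis region_Inter_eq)+
  ultimately show ?thesis
    unfolding intersection_poset_def by simp
qed

lemma mobius_poset:
  assumes "u \<in> poset"
  shows "mobius poset region u =
    (\<Sum>S | S \<subseteq> off_diagonal \<and> region \<inter> flat S = u. (-1) ^ card S)"
proof -
  obtain y where y: "y \<in> region" "distinct_entries y"
    by (rule region_distinct)
  have "\<not> region \<subseteq> (case i of (j, k) \<Rightarrow> hyperplane_eq j k \<inter> slice)"
    if "i \<in> off_diagonal" for i
    using that y by (auto simp: hyperplane_eq_def distinct_entries_def inj_eq off_diagonal_def)
  then show ?thesis
    using mobius_intersection_poset[OF finite_off_diagonal, of region
        "\<lambda>(j, k). hyperplane_eq j k \<inter> slice" u] assms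
    unfolding induced_arrangement_slice region_Inter_eq by blast
qed

text \<open>All \<open>S\<close> cutting out \<open>u\<close> give the same subspace
  \<open>F\<close>, so the Whitney sum is the Moebius value up to one common sign; being
  nonnegative, it is the absolute value.\<close>

lemma abs_mobius_poset:
  assumes "u \<in> poset"
  shows "\<bar>mobius poset region u\<bar> =
    (\<Sum>S | S \<subseteq> off_diagonal \<and> region \<inter> flat S = u. whitney_term V coord_diff S)"
proof -
  obtain T where u: "u = region \<inter> flat T"
    using assms poset_eq by blast
  define F where "F = V \<inter> common_zeros coord_diff T"
  let ?A = "{S. S \<subseteq> off_diagonal \<and> region \<inter> flat S = u}"
  let ?W = "\<Sum>S\<in>?A. whitney_term V coord_diff S"
  have A: "?A = {S. S \<subseteq> off_diagonal \<and> V \<inter> common_zeros coord_diff S = F}"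
    unfolding u F_def region_flat_eq_iff flat_eq_iff ..
  have "0 \<le> ?W"
    unfolding A by (intro whitney_sum_nonneg finite_off_diagonal linear_coord_diff V)
  moreover have "?W = (-1) ^ (dim V + dim F) * mobius poset region u"
    unfolding mobius_poset[OF assms] sum_distrib_left A
    by (intro sum.cong refl) (auto simp: whitney_term_def power_add)
  then have "\<bar>?W\<bar> = \<bar>mobius poset region u\<bar>"
    by (simp add: abs_mult power_abs)
  ultimately show ?thesis by simp
qed

section \<open>Exchange of summations over flats and lattice points\<close>

lemma sum_poset:
  fixes c :: "('n \<times> 'n) set \<Rightarrow> int"
  assumes "\<And>u. u \<in> poset \<Longrightarrow> \<phi> u = (\<Sum>S | S \<subseteq> off_diagonal \<and> region \<inter> flat S = u. c S)"
  shows "(\<Sum>u\<in>poset. \<phi> u * \<psi> u) = (\<Sum>S\<in>Pow off_diagonal. c S * \<psi> (region \<inter> flat S))"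
proof -
  have "(\<Sum>u\<in>poset. \<phi> u * \<psi> u) =
      (\<Sum>u\<in>poset. \<Sum>S | S \<in> Pow off_diagonal \<and> region \<inter> flat S = u. c S * \<psi> (region \<inter> flat S))"
    by (intro sum.cong refl) (simp add: assms sum_distrib_right)
  also have "\<dots> = (\<Sum>S\<in>Pow off_diagonal. c S * \<psi> (region \<inter> flat S))"
    unfolding poset_eq by (intro sum.group) auto
  finally show ?thesis .
qed

text \<open>The hyperplanes pass through the origin, so dilation by a positive factor preserves
  ties.\<close>

lemma ehrhart_flat:
  assumes "S \<subseteq> off_diagonal" and "1 \<le> t"
  shows "ehrhart (Q \<inter> flat S) t = card {x \<in> integer_points (dilate t (Q \<inter> slice)). S \<subseteq> ties x}"
proof -
  have "dilate t (Q \<inter> flat S) = {x \<in> dilate t (Q \<inter> slice). S \<subseteq> ties x}"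
    using assms mem_common_zeros_coord_diff[OF assms(1)]
    by (auto simp: dilate_def flat_def ties_scaleR)
  then show ?thesis
    unfolding ehrhart_def integer_points_def by (intro arg_cong[of _ _ card]) auto
qed

text \<open>The index set \<open>S\<close> is counted at \<open>x\<close> exactly when
  \<open>S \<subseteq> ties x\<close>, so exchanging the sums leaves a local sum at each lattice
  point.\<close>

lemma sum_poset_ehrhart:
  fixes c :: "('n \<times> 'n) set \<Rightarrow> int"
  assumes \<phi>: "\<And>u. u \<in> poset \<Longrightarrow> \<phi> u = (\<Sum>S | S \<subseteq> off_diagonal \<and> region \<inter> flat S = u. c S)"
    and "1 \<le> t" and fin: "finite (integer_points (dilate t (Q \<inter> slice)))"
  shows "(\<Sum>u\<in>poset. \<phi> u * int (ehrhart (Q \<inter> flat_of slice region (induced_arrangement slice) u) t)) =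
    (\<Sum>x\<in>integer_points (dilate t (Q \<inter> slice)). \<Sum>S\<in>Pow (ties x). c S)"
proof -
  let ?X = "integer_points (dilate t (Q \<inter> slice))"
  have "(\<Sum>u\<in>poset. \<phi> u * int (ehrhart (Q \<inter> flat_of slice region (induced_arrangement slice) u) t)) =
      (\<Sum>S\<in>Pow off_diagonal. c S * int (ehrhart (Q \<inter> flat_of slice region
        (induced_arrangement slice) (region \<inter> flat S)) t))"
    using \<phi> by (rule sum_poset)
  also have "\<dots> = (\<Sum>S\<in>Pow off_diagonal. c S * int (card {x \<in> ?X. S \<subseteq> ties x}))"
    by (intro sum.cong refl) (simp add: flat_of_eq ehrhart_flat[OF _ \<open>1 \<le> t\<close>])
  also have "\<dots> = (\<Sum>S\<in>Pow off_diagonal. \<Sum>x | x \<in> ?X \<and> S \<subseteq> ties x. c S)"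
    by (simp add: mult.commute)
  also have "\<dots> = (\<Sum>x\<in>?X. \<Sum>S | S \<in> Pow off_diagonal \<and> S \<subseteq> ties x. c S)"
    using fin by (intro sum.swap_restrict) auto
  also have "\<dots> = (\<Sum>x\<in>?X. \<Sum>S\<in>Pow (ties x). c S)"
    using ties_subset by (intro sum.cong refl) blast+
  finally show ?thesis .
qed

text \<open>Near \<open>y\<close> only the hyperplanes through \<open>y\<close> matter, so the realizable orderings compatible
  with \<open>y\<close> are the regions of the localized arrangement.\<close>

lemma card_compatible_realizable:
  assumes y: "y \<in> slice"
  shows "card {\<sigma>. \<sigma> permutes UNIV \<and> compatible y \<sigma> \<and> realizable_in region \<sigma>} =
    card (sign_regions V coord_diff (ties y))"
proof -
  \<comment> \<open>These are the pairs tied at \<open>y\<close> whose difference is positive at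
    every point realizing \<open>\<sigma>\<close>.\<close>
  define G where "G \<sigma> = {(j, k) \<in> ties y. inv \<sigma> k < inv \<sigma> j}" for \<sigma> :: "'n \<Rightarrow> 'n"
  let ?A = "{\<sigma>. \<sigma> permutes UNIV \<and> compatible y \<sigma> \<and> realizable_in region \<sigma>}"
  have "inj_on G ?A"
  proof (rule inj_onI)
    fix \<sigma> \<tau> assume \<sigma>: "\<sigma> \<in> ?A" and \<tau>: "\<tau> \<in> ?A" and eq: "G \<sigma> = G \<tau>"
    \<comment> \<open>Compatibility fixes the order of coordinates that differ in \<open>y\<close>;
      the order of tied ones is read off from \<open>G\<close>.\<close>
    have *: "inv \<sigma> j < inv \<sigma> k \<longleftrightarrow> inv \<tau> j < inv \<tau> k" for j k
    proof -
      consider "j = k" | "y $ j < y $ k" | "y $ k < y $ j" | "j \<noteq> k" "y $ j = y $ k"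
        by linarith
      then show ?thesis
      proof cases
        case 4
        then have "(k, j) \<in> ties y"
          by (simp add: ties_def off_diagonal_def coord_diff_def)
        then show ?thesis
          using eq unfolding G_def by blast
      qed (use \<sigma> \<tau> compatible_lessD[of _ y] in \<open>auto dest: less_asym\<close>)
    qed
    show "\<sigma> = \<tau>"
      using \<sigma> \<tau> * by (intro permutation_eqI_inv_less) auto
  qed
  moreover have "G ` ?A = sign_regions V coord_diff (ties y)"
  proof
    show "G ` ?A \<subseteq> sign_regions V coord_diff (ties y)"
    proof clarify
      fix \<sigma> assume \<sigma>: "\<sigma> permutes UNIV" "realizable_in region \<sigma>"
      then obtain w where w: "w \<in> region" "realizes w \<sigma>"
        unfolding realizable_in_def by blast
      note less = realizes_less_iff[OF \<sigma>(1) w(2)]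
      have "w - diag \<in> V"
        using w by (simp add: region_def slice_def)
      moreover have "\<forall>i\<in>G \<sigma>. 0 < coord_diff i (w - diag)"
        unfolding coord_diff_diff by (auto simp: G_def less coord_diff_def)
      moreover have "\<forall>i\<in>ties y - G \<sigma>. coord_diff i (w - diag) < 0"
      proof clarify
        fix j k assume jk: "(j, k) \<in> ties y" "(j, k) \<notin> G \<sigma>"
        then have "\<not> inv \<sigma> k < inv \<sigma> j" "j \<noteq> k"
          by (auto simp: G_def ties_def off_diagonal_def)
        then have "inv \<sigma> j < inv \<sigma> k"
          using \<sigma>(1) by (metis linorder_neqE permutes_inverses(1))
        then show "coord_diff (j, k) (w - diag) < 0"
          unfolding coord_diff_diff by (simp add: less coord_diff_def)
      qed
      ultimately show "G \<sigma> \<in> sign_regions V coord_diff (ties y)"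
        unfolding sign_regions_def by (auto simp: G_def)
    qed
    show "sign_regions V coord_diff (ties y) \<subseteq> G ` ?A"
    proof
      fix T assume "T \<in> sign_regions V coord_diff (ties y)"
      then obtain v where T: "T \<subseteq> ties y" and v: "v \<in> V"
        "\<And>i. i \<in> T \<Longrightarrow> 0 < coord_diff i v" "\<And>i. i \<in> ties y - T \<Longrightarrow> coord_diff i v < 0"
        unfolding sign_regions_def by blast
      have nz: "\<And>i. i \<in> off_diagonal - ties y \<Longrightarrow> coord_diff i y \<noteq> 0"
        by (auto simp: ties_def)
      obtain e where e: "0 < e"
        "\<And>i. i \<in> off_diagonal - ties y \<Longrightarrow> \<bar>e * coord_diff i v\<bar> < \<bar>coord_diff i y\<bar>"
        using small_perturbation[of "off_diagonal - ties y" "\<lambda>i. coord_diff i y"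
            "\<lambda>i. coord_diff i v"] nz finite_Diff[OF finite_off_diagonal]
        by metis
      \<comment> \<open>Moving slightly along \<open>v\<close> breaks the ties according to
        \<open>T\<close> and keeps the sign of every other difference.\<close>
      define w where "w = y + e *\<^sub>R v"
      have w: "coord_diff i w = coord_diff i y + e * coord_diff i v" for i
        by (simp add: w_def coord_diff_add_scaleR)
      have tie: "coord_diff i w = e * coord_diff i v" if "i \<in> ties y" for i
        using that by (simp add: w ties_def)
      have pos: "0 < coord_diff i w" if "i \<in> T" for i
        using v(2)[OF that] subsetD[OF T that] e(1) tie by simp
      have neg: "coord_diff i w < 0" if "i \<in> ties y - T" for i
        using that v(3)[OF that] e(1) tie by (simp add: mult_pos_neg)
      have "ties w = {}"
      proof -
        have "coord_diff i w \<noteq> 0" if "i \<in> off_diagonal" for i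
        proof (cases "i \<in> ties y")
          case True
          then show ?thesis using pos[of i] neg[of i] by force
        next
          case False
          then show ?thesis using e(2)[of i] that w[of i] by force
        qed
        then show ?thesis by (auto simp: ties_def)
      qed
      then obtain \<sigma> where \<sigma>: "\<sigma> permutes UNIV" "realizes w \<sigma>"
        using realizing_permutation_exists ties_empty_iff by blast
      note less = realizes_less_iff[OF \<sigma>]
      have shift: "w - diag = (y - diag) + e *\<^sub>R v" by (simp add: w_def)
      have "y - diag \<in> V" using y by (simp add: slice_def)
      then have "w - diag \<in> V"
        unfolding shift using v(1) V by (intro subspace_add subspace_scale)
      then have "w \<in> slice" by (simp add: slice_def)
      \<comment> \<open>The point \<open>w\<close> may have nonpositive entries; contraction brings
        it into the region with the same coordinate order.\<close>
      then obtain d where d: "0 < d" "diag + d *\<^sub>R (w - diag) \<in> region"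
        by (rule contract_into_region)
      have "realizes (diag + d *\<^sub>R (w - diag)) \<sigma>"
        using \<sigma>(2) d(1) by (simp add: realizes_def strict_mono_def)
      then have "realizable_in region \<sigma>"
        using d(2) by (auto simp: realizable_in_def)
      \<comment> \<open>A strict inequality of \<open>y\<close> violating the order would survive in
        \<open>w\<close>, which realizes \<open>\<sigma>\<close>.\<close>
      moreover have "compatible y \<sigma>"
        unfolding compatible_def
      proof (rule monoI, rule ccontr)
        fix i j assume ij: "i \<le> j" "\<not> y $ \<sigma> i \<le> y $ \<sigma> j"
        then have "(\<sigma> i, \<sigma> j) \<in> off_diagonal - ties y"
          by (auto simp: off_diagonal_def ties_def coord_diff_def)
        then have "0 < coord_diff (\<sigma> i, \<sigma> j) w"
          using e(2)[of "(\<sigma> i, \<sigma> j)"] w[of "(\<sigma> i, \<sigma> j)"] ij(2)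
          by (auto simp: coord_diff_def)
        then have "w $ \<sigma> j < w $ \<sigma> i" by (simp add: coord_diff_def)
        moreover have "w $ \<sigma> i \<le> w $ \<sigma> j"
          using strict_mono_less_eq[OF \<sigma>(2)[unfolded realizes_def], of i j] ij(1) by simp
        ultimately show False by simp
      qed
      moreover have "T = G \<sigma>"
      proof -
        have "i \<in> T \<longleftrightarrow> 0 < coord_diff i w" if "i \<in> ties y" for i
          using that pos[of i] neg[of i] by force
        then show ?thesis
          using T by (auto simp: G_def less coord_diff_def)
      qed
      ultimately show "T \<in> G ` ?A"
        using \<sigma>(1) by blast
    qed
  qed
  ultimately show ?thesis
    by (metis card_image)
qed

section \<open>The two counting formulas on a slice\<close>

text \<open>The local alternating sum is 1 at a point without ties and 0 elsewhere.\<close>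

lemma strict_count:
  assumes t: "1 \<le> t" and fin: "finite (integer_points (dilate t (open_orthant \<inter> slice)))"
  shows "(\<Sum>u\<in>poset. mobius poset region u *
      int (ehrhart (open_orthant \<inter> flat_of slice region (induced_arrangement slice) u) t)) =
    int (card {x \<in> integer_points (dilate t (open_orthant \<inter> slice)). distinct_entries x})"
proof -
  let ?X = "integer_points (dilate t (open_orthant \<inter> slice))"
  have "(\<Sum>x\<in>?X. \<Sum>S\<in>Pow (ties x). (-1) ^ card S) =
      (\<Sum>x\<in>?X. if distinct_entries x then 1 else 0 :: int)"
    by (intro sum.cong refl)
       (simp add: sum_Pow_neg_one_card ties_empty_iff finite_subset[OF ties_subset])
  also have "\<dots> = int (card {x \<in> ?X. distinct_entries x})"
    using fin by (simp flip: sum.inter_filter)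
  finally show ?thesis
    using sum_poset_ehrhart[OF mobius_poset t fin] by simp
qed

text \<open>The local Whitney sum counts the regions of the arrangement localized at
  \<open>x\<close>, hence the admissible permutations. Dividing by \<open>t\<close> moves
  \<open>x\<close> into the slice and changes neither ties nor compatibility.\<close>

lemma weak_count:
  assumes t: "1 \<le> t" and fin: "finite (integer_points (dilate t (orthant \<inter> slice)))"
  shows "(\<Sum>u\<in>poset. \<bar>mobius poset region u\<bar> *
      int (ehrhart (orthant \<inter> flat_of slice region (induced_arrangement slice) u) t)) =
    int (card (SIGMA x:integer_points (dilate t (orthant \<inter> slice)).
      {\<sigma>. \<sigma> permutes UNIV \<and> compatible x \<sigma> \<and> realizable_in region \<sigma>}))"
proof -
  let ?X = "integer_points (dilate t (orthant \<inter> slice))"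
  let ?C = "\<lambda>x. {\<sigma>. \<sigma> permutes UNIV \<and> compatible x \<sigma> \<and> realizable_in region \<sigma>}"
  have "(\<Sum>S\<in>Pow (ties x). whitney_term V coord_diff S) = int (card (?C x))" if x: "x \<in> ?X" for x
  proof -
    obtain y where y: "y \<in> slice" "x = real t *\<^sub>R y"
      using x unfolding integer_points_def dilate_def by blast
    have "?C x = ?C y"
      using t by (simp add: y(2) compatible_def mono_def)
    moreover have "ties x = ties y"
      using t by (simp add: y(2) ties_scaleR)
    ultimately show ?thesis
      using card_compatible_realizable[OF y(1)] card_sign_regions[OF _ _ V, of "ties y" coord_diff]
      by (simp add: linear_coord_diff finite_subset[OF ties_subset])
  qed
  then have "(\<Sum>x\<in>?X. \<Sum>S\<in>Pow (ties x). whitney_term V coord_diff S) = int (card (Sigma ?X ?C))"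
    using fin by simp
  then show ?thesis
    using sum_poset_ehrhart[OF abs_mobius_poset t fin] by simp
qed

end

section \<open>From linear forms of constant weight to a slice through the diagonal\<close>

theorem theorem3p17:
  fixes f :: "nat \<Rightarrow> real^'n::{finite,linorder} \<Rightarrow> real"
    and m t :: nat
  assumes forms: "\<forall>i\<in>{1..m}. rational_linear_form (f i)"
    and weight: "\<exists>c>0. \<forall>i\<in>{1..m}. f i (\<chi> j. 1) = c"
    and cover: "\<forall>j. \<exists>i\<in>{1..m}. appears_in j (f i)"
    and consistent: "solution_space m f \<noteq> {}"
    and magic: "\<exists>x. magic_labelling m f x"
    and t: "1 \<le> t"
  shows
    "let s = solution_space m f;
         P\<^sub>0 = rel_interior (magic_polytope m f);
         \<H> = induced_arrangement s;
         L = intersection_poset P\<^sub>0 \<H>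
     in (finite (integer_points (dilate t (open_orthant \<inter> s))) \<longrightarrow>
           int (strict_magic_count m f t) =
             (\<Sum>u\<in>L. mobius L P\<^sub>0 u * int (ehrhart (open_orthant \<inter> flat_of s P\<^sub>0 \<H> u) t))) \<and>
        (finite (integer_points (dilate t (magic_polytope m f))) \<longrightarrow>
           int (weak_magic_count m f t) =
             (\<Sum>u\<in>L. \<bar>mobius L P\<^sub>0 u\<bar> * int (ehrhart (orthant \<inter> flat_of s P\<^sub>0 \<H> u) t)))"
proof -
  obtain c where c: "0 < c" "\<And>i. i \<in> {1..m} \<Longrightarrow> f i (\<chi> j. 1) = c"
    using weight by blast
  have lin: "linear (f i)" if "i \<in> {1..m}" for i
    using forms that by (simp add: rational_linear_form_def)
  have const: "f i (\<chi> j. r) = r * c" if "i \<in> {1..m}" for i r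
  proof -
    have "(\<chi> j. r) = r *\<^sub>R ((\<chi> j. 1) :: (real, 'n) vec)" by (simp add: vec_eq_iff)
    then show ?thesis using c(2)[OF that] lin[OF that] by (simp add: linear_cmul)
  qed
  define V where "V = {v. \<forall>i\<in>{1..m}. f i v = 0}"
  have V: "subspace V"
    using lin by (auto simp: V_def subspace_def linear_0 linear_add linear_cmul)
  obtain x where x: "magic_labelling m f x"
    using magic by blast
  \<comment> \<open>Every form takes the value \<open>f 1 x\<close> both on the labelling and on the
    subtracted constant vector, so the difference lies in \<open>V\<close>; its entries remain
    distinct.\<close>
  define z where "z = x - (\<chi> j. f 1 x / c)"
  have "f i z = 0" if i: "i \<in> {1..m}" for i
  proof -
    have "1 \<in> {1..m}" using i by auto
    then have "f i x = f 1 x"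
      using x i unfolding magic_labelling_def by blast
    then show ?thesis
      using const[OF i] lin[OF i] c(1) by (simp add: z_def linear_diff)
  qed
  then have "z \<in> V" by (simp add: V_def)
  moreover have "distinct_entries z"
    using x by (simp add: magic_labelling_def distinct_entries_def z_def inj_def)
  \<comment> \<open>Every form equals 1 on the constant vector with entries \<open>1 / c\<close>,
    which serves as the diagonal point.\<close>
  ultimately interpret diagonal_slice V "1 / c" z
    using V c(1) by unfold_locales auto
  have s: "solution_space m f = slice"
    using const lin c(1) unfolding solution_space_def slice_def by (auto simp: V_def linear_diff)
  have P: "rel_interior (magic_polytope m f) = region"
    by (simp add: magic_polytope_def s rel_interior_slice_orthant)
  have polytope: "magic_polytope m f = orthant \<inter> slice"
    by (auto simp: magic_polytope_def s)
  \<comment> \<open>As \<open>t \<ge> 1\<close>, a dilated point is positive exactly when the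
    original one is.\<close>
  have "{x \<in> integer_points (dilate t (orthant \<inter> slice)). distinct_entries x \<and> (\<forall>j. 0 < x $ j)} =
      {x \<in> integer_points (dilate t (open_orthant \<inter> slice)). distinct_entries x}"
    using t
    by (auto simp: integer_points_def dilate_def orthant_def open_orthant_def less_imp_le
        zero_less_mult_iff)
  then have strict: "strict_magic_count m f t =
      card {x \<in> integer_points (dilate t (open_orthant \<inter> slice)). distinct_entries x}"
    by (simp add: strict_magic_count_def polytope)
  have weak: "weak_magic_count m f t = card (SIGMA x:integer_points (dilate t (orthant \<inter> slice)).
      {\<sigma>. \<sigma> permutes UNIV \<and> compatible x \<sigma> \<and> realizable_in region \<sigma>})"
    unfolding weak_magic_count_def P unfolding polytope
    by (rule arg_cong[of _ _ card])
       (auto simp: integer_points_def dilate_def orthant_def)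
  show ?thesis
    unfolding Let_def s P using strict_count[OF t] weak_count[OF t]
    by (simp add: strict weak polytope)
qed

end
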